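(* The SOF cost $J$ is coercive: for every sequence $\{K_i\}_{i=1}^\infty\subseteq\mathbb{K}$, $$J(K_i)\to+\infty\quad\text{if } K_i\to K\in\partial\mathbb{K}\ \text{ or }\ \|K_i\|\to+\infty .$$
   Context: Setting (static output feedback, SOF). $A\in\mathbb{R}^{n\times n}$, $B\in\mathbb{R}^{n\times m}$, $C\in\mathbb{R}^{d\times n}$; $(A,B)$ is controllable, $(C,A)$ is observable, and $C$ has linearly independent rows. $Q\in\mathbb{R}^{n\times n}$ and $R\in\mathbb{R}^{m\times m}$ are symmetric positive definite. $\mathcal{D}$ is a probability distribution on $\mathbb{R}^n$ with $X_0:=\mathbb{E}_{x_0\sim\mathcal{D}}[x_0x_0^\top]\succ 0$. For $K\in\mathbb{R}^{m\times d}$ put $\mathcal{A}_K:=A-BKC$. The set of stabilizing gains is $\mathbb{K}:=\{K\in\mathbb{R}^{m\times d}:\rho(\mathcal{A}_K)<1\}$ ($\rho$ is the spectral radius), assumed nonempty, and $\partial\mathbb{K}$ is its boundary in $\mathbb{R}^{m\times d}$. For $K\in\mathbb{K}$, $$J(K):=\mathbb{E}_{x_0\sim\mathcal{D}}\Big[\sum_{t=0}^\infty x_t^\top(Q+C^\top K^\top RKC)x_t\Big],\quad x_{t+1}=\mathcal{A}_Kx_t .$$ Equivalently $J(K)=\mathrm{Tr}(P_KX_0)$, where $P_K=Q+C^\top K^\top RKC+\mathcal{A}_K^\top P_K\mathcal{A}_K$. $\|\cdot\|$ is the induced 2-norm. *)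

theory Defs
  imports "HOL-Probability.Probability"
begin

primrec mpow :: "'a::semiring_1^'n^'n \<Rightarrow> nat \<Rightarrow> 'a^'n^'n" where
  "mpow M 0 = mat 1"
| "mpow M (Suc k) = M ** mpow M k"

(* Kalman rank conditions: the block matrices [B, AB, ..., A^(n-1) B] and
   [C; CA; ...; C A^(n-1)] have rank n. *)
definition controllable :: "real^'n^'n \<Rightarrow> real^'m^'n \<Rightarrow> bool" where
  "controllable A B \<longleftrightarrow> dim (\<Union>k<CARD('n). columns (mpow A k ** B)) = CARD('n)"

definition observable :: "real^'n^'d \<Rightarrow> real^'n^'n \<Rightarrow> bool" where
  "observable C A \<longleftrightarrow> dim (\<Union>k<CARD('n). rows (C ** mpow A k)) = CARD('n)"

(* Injectivity excludes repeated rows, which the set rows C does not see. *)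
definition independent_rows :: "real^'n^'d \<Rightarrow> bool" where
  "independent_rows C \<longleftrightarrow> inj (\<lambda>i. row i C) \<and> independent (rows C)"

definition sym_pos_def :: "real^'n^'n \<Rightarrow> bool" where
  "sym_pos_def M \<longleftrightarrow> transpose M = M \<and> (\<forall>x. x \<noteq> 0 \<longrightarrow> x \<bullet> (M *v x) > 0)"

definition complex_eigenvalues :: "real^'n^'n \<Rightarrow> complex set" where
  "complex_eigenvalues M =
     {z. \<exists>v::complex^'n. v \<noteq> 0 \<and> (\<chi> i j. complex_of_real (M $ i $ j)) *v v = z *s v}"

(* The set of eigenvalues is finite and nonempty, so that Max is meaningful. *)
definition spec_rad :: "real^'n^'n \<Rightarrow> real" where
  "spec_rad M = Max (cmod ` complex_eigenvalues M)"

definition outer_square :: "real^'n \<Rightarrow> real^'n^'n" where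
  "outer_square x = (\<chi> i j. x $ i * x $ j)"

definition closed_loop ::
  "real^'n^'n \<Rightarrow> real^'m^'n \<Rightarrow> real^'n^'d \<Rightarrow> real^'d^'m \<Rightarrow> real^'n^'n" where
  "closed_loop A B C K = A - B ** K ** C"

definition stabilizing_gains ::
  "real^'n^'n \<Rightarrow> real^'m^'n \<Rightarrow> real^'n^'d \<Rightarrow> (real^'d^'m) set" where
  "stabilizing_gains A B C = {K. spec_rad (closed_loop A B C K) < 1}"

primrec trajectory :: "real^'n^'n \<Rightarrow> real^'n \<Rightarrow> nat \<Rightarrow> real^'n" where
  "trajectory M x 0 = x"
| "trajectory M x (Suc t) = M *v trajectory M x t"

(* Only meaningful for stabilizing K (and finite second moments of D): there the series
   converges for every initial state and its sum is integrable. *)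
definition sof_cost ::
  "real^'n^'n \<Rightarrow> real^'m^'n \<Rightarrow> real^'n^'d \<Rightarrow> real^'n^'n \<Rightarrow> real^'m^'m \<Rightarrow> (real^'n) measure
     \<Rightarrow> real^'d^'m \<Rightarrow> real" where
  "sof_cost A B C Q R D K =
     (\<integral>x0. (\<Sum>t. trajectory (closed_loop A B C K) x0 t \<bullet>
        ((Q + transpose C ** transpose K ** R ** K ** C)
           *v trajectory (closed_loop A B C K) x0 t)) \<partial>D)"

end

(* A complex polynomial annihilating a matrix shows that its spectrum is finite and nonempty, and peeling
   off the linear factors of this polynomial shows that rho(M) < 1 makes the norms of the powers M^t
   summable. Hence J(K) is the sum over t of E[x_t^T (Q + C^T K^T R K C) x_t], and positive definiteness
   of Q, R and X0 gives a constant a > 0, independent of K, such that J(K) dominates both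
   a ||K C||^2 and every partial sum of a ||M^t||^2 with M = A - BKC. As C has a right inverse,
   ||K|| -> infinity forces J(K) -> infinity by the first bound. If K_i -> K with J(K_i) not tending
   to infinity, the second bound passes to the limit and is finite for K, so some power of A - BKC is
   small; the same power is small for all gains near K, so K is an interior point of the set of
   stabilizing gains and not a boundary point. *)
theory Submission
  imports Defs "HOL-Computational_Algebra.Fundamental_Theorem_Algebra"
begin

section \<open>Matrix arithmetic\<close>

text \<open>In finite dimension every bilinear map is bounded. The matrix norm used throughout is
  the Euclidean norm of the entries, and the product estimates carry an unspecified constant
  \<open>c\<close>.\<close>

lemma bounded_bilinear_matrix_matrix_mult:
  "bounded_bilinear ((**) :: 'a::{euclidean_space,real_algebra_1}^'n^'m \<Rightarrow> 'a^'p^'n \<Rightarrow> 'a^'p^'m)"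
  unfolding bilinear_conv_bounded_bilinear[symmetric] bilinear_def linear_iff
  by (auto simp: vec_eq_iff matrix_matrix_mult_def algebra_simps sum.distrib scaleR_sum_right)

lemma bounded_bilinear_matrix_vector_mult:
  "bounded_bilinear ((*v) :: 'a::{euclidean_space,real_algebra_1}^'n^'m \<Rightarrow> 'a^'n \<Rightarrow> 'a^'m)"
  unfolding bilinear_conv_bounded_bilinear[symmetric] bilinear_def linear_iff
  by (auto simp: vec_eq_iff matrix_vector_mult_def algebra_simps sum.distrib scaleR_sum_right)

lemma matrix_diff_rdistrib: "((A - B) ** C) = (A ** C) - (B ** (C :: 'a::ring_1^'p^'n))"
  by (vector matrix_matrix_mult_def sum_subtractf algebra_simps)

lemma matrix_add_rdistrib: "((A + B) ** C) = (A ** C) + (B ** (C :: 'a::semiring_1^'p^'n))"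
  by (vector matrix_matrix_mult_def sum.distrib algebra_simps)

lemma matrix_diff_ldistrib: "(C ** (A - B)) = (C ** A) - ((C :: 'a::ring_1^'n^'p) ** B)"
  by (vector matrix_matrix_mult_def sum_subtractf algebra_simps)

lemma mat_mult_nth: "(mat z ** X) $ i $ j = z * (X :: 'a::semiring_1^'n^'m) $ i $ j"
  by (simp add: matrix_matrix_mult_def mat_def if_distrib[of "\<lambda>u. u * _"] cong: if_cong)

lemma mult_mat_nth: "(X ** mat z) $ i $ j = (X :: 'a::semiring_1^'n^'m) $ i $ j * z"
  by (simp add: matrix_matrix_mult_def mat_def if_distrib cong: if_cong)

lemma mat_mult_commute: "mat z ** X = X ** mat (z :: 'a::comm_semiring_1)"
  by (simp add: vec_eq_iff mat_mult_nth mult_mat_nth mult.commute)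

lemma mat_mult_vec: "mat z *v v = z *s (v :: 'a::semiring_1^'n)"
  by (simp add: vec_eq_iff matrix_vector_mult_def mat_def if_distrib[of "\<lambda>u. u * _"] cong: if_cong)

lemma mat_add: "mat (a + b) = mat a + (mat b :: 'a::semiring_1^'n^'n)"
  by (simp add: vec_eq_iff mat_def)

lemma mat_mult_mat: "mat a ** mat b = (mat (a * b) :: 'a::semiring_1^'n^'n)"
  unfolding vec_eq_iff mat_mult_nth by (simp add: mat_def)

lemma norm_mat_mult:
  "norm (mat z ** X) = norm z * norm (X :: 'a::{real_normed_div_algebra}^'n^'m)"
proof -
  have "mat z ** X = (\<chi> i. \<chi> j. z * X $ i $ j)"
    by (simp add: vec_eq_iff mat_mult_nth)
  thus ?thesis
    by (simp add: norm_vec_def norm_mult L2_set_right_distrib)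
qed

lemma mpow_commute: "mpow M k ** M = M ** mpow M k"
  by (induction k) (simp_all add: matrix_mul_assoc[symmetric])

section \<open>Polynomials of a matrix and its eigenvalues\<close>

text \<open>Horner's scheme, with the coefficients embedded as scalar matrices and with
  \<open>**\<close> as the product.\<close>

definition peval :: "'a::comm_ring_1^'n^'n \<Rightarrow> 'a poly \<Rightarrow> 'a^'n^'n" where
  "peval M p = fold_coeffs (\<lambda>a X. mat a + M ** X) p 0"

lemma peval_0 [simp]: "peval M 0 = 0"
  by (simp add: peval_def)

lemma peval_pCons [simp]: "peval M (pCons a p) = mat a + M ** peval M p"
\<comment> \<open>Folding over \<open>pCons 0 0\<close> performs no Horner step, so this case is
  checked separately: both sides are 0.\<close>
proof (cases "p = 0 \<and> a = 0")
  case True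
  then show ?thesis
    by (simp add: peval_def vec_eq_iff mat_def)
next
  case False
  then show ?thesis
    by (cases "p = 0") (simp_all add: peval_def)
qed

lemma peval_add: "peval M (p + q) = peval M p + peval M q"
  by (induction p q rule: poly_induct2) (simp_all add: mat_add matrix_add_ldistrib)

lemma peval_smult: "peval M (smult c p) = mat c ** peval M p"
proof (induction p)
  case 0
  then show ?case by (simp add: vec_eq_iff mat_mult_nth)
next
  case (pCons a p)
  have "M ** (mat c ** peval M p) = mat c ** (M ** peval M p)"
    by (simp only: matrix_mul_assoc mat_mult_commute[of c M])
  then show ?case
    by (simp add: pCons matrix_add_ldistrib mat_mult_mat)
qed

lemma peval_mult: "peval M (p * q) = peval M p ** peval M q"
  by (induction p)
     (simp_all add: peval_add peval_smult matrix_add_rdistrib matrix_mul_assoc)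

lemma peval_sum: "peval M (\<Sum>i\<in>I. f i) = (\<Sum>i\<in>I. peval M (f i))"
  by (induction I rule: infinite_finite_induct) (simp_all add: peval_add)

lemma peval_monom: "peval M (monom a k) = mat a ** mpow M k"
  by (induction k) (simp_all add: monom_0 monom_Suc matrix_mul_assoc mat_mult_commute[of a M])

lemma peval_1 [simp]: "peval M 1 = mat 1"
  by (simp add: one_pCons)

lemma peval_linear_factor: "peval M [:-z, 1:] = M - mat z"
  by (simp, simp add: vec_eq_iff mat_def)

lemma peval_eigenvector:
  fixes M :: "'a::field^'n^'n"
  assumes "M *v v = z *s v"
  shows "peval M p *v v = poly p z *s v"
proof (induction p)
  case 0
  then show ?case by simp
next
  case (pCons a p)
  have "peval M (pCons a p) *v v = a *s v + M *v (peval M p *v v)"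
    by (simp add: matrix_vector_mult_add_rdistrib mat_mult_vec matrix_vector_mul_assoc)
  also have "\<dots> = poly (pCons a p) z *s v"
    by (simp add: pCons assms vector_scalar_commute vec.scale_left_distrib mult.commute)
  finally show ?case .
qed

section \<open>Annihilating polynomials and the existence of eigenvalues\<close>

text \<open>The powers of \<open>M\<close> up to the real dimension of the matrix space are one too
  many to be independent. If they are distinct, a linear relation among them gives \<open>p\<close>.
  If two coincide, the set of powers hides the repetition, and the difference of two monomials
  serves instead.\<close>

lemma annihilating_poly:
  fixes M :: "complex^'n^'n"
  obtains p where "p \<noteq> 0" "peval M p = 0"
proof (cases "inj_on (mpow M) {..DIM(complex^'n^'n)}")
  case True
  let ?S = "mpow M ` {..DIM(complex^'n^'n)}"
  have "card ?S > DIM(complex^'n^'n)"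
    unfolding card_image[OF True] by simp
  then have "dependent ?S"
    by (metis independent_bound not_less)
  then obtain u v where u: "(\<Sum>X\<in>?S. u X *\<^sub>R X) = 0" and v: "v \<in> ?S" "u v \<noteq> 0"
    by (auto simp: dependent_finite)
  obtain k where k: "k \<le> DIM(complex^'n^'n)" "u (mpow M k) \<noteq> 0"
    using v by auto
  define p where "p = (\<Sum>i\<le>DIM(complex^'n^'n). monom (complex_of_real (u (mpow M i))) i)"
  have "coeff p k = u (mpow M k)"
    using k by (simp add: p_def coeff_sum if_distrib cong: if_cong)
  then have "p \<noteq> 0"
    using k by auto
  moreover have "mat (complex_of_real c) ** X = c *\<^sub>R X" for c and X :: "complex^'n^'n"
    unfolding vec_eq_iff mat_mult_nth by (simp add: scaleR_conv_of_real[symmetric])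
  then have "peval M p = 0"
    using u unfolding sum.reindex[OF True] by (simp add: p_def peval_sum peval_monom)
  ultimately show ?thesis
    using that by blast
next
  case False
  then obtain i j where ij: "i \<noteq> j" "mpow M i = mpow M j"
    by (auto simp: inj_on_def)
  let ?p = "monom 1 i + monom (-1) j :: complex poly"
  have "coeff ?p i = 1"
    using ij by simp
  then have "?p \<noteq> 0"
    by (metis coeff_0 zero_neq_one)
  moreover have "peval M ?p = 0"
    by (simp add: peval_add peval_monom ij) (simp add: vec_eq_iff mat_mult_nth)
  ultimately show ?thesis
    using that by blast
qed

definition eigenvalues :: "'a::field^'n^'n \<Rightarrow> 'a set" where
  "eigenvalues M = {z. \<exists>v. v \<noteq> 0 \<and> M *v v = z *s v}"

text \<open>Every eigenvalue is a root of an annihilating polynomial, by applying that polynomial to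
  an eigenvector.\<close>

lemma finite_eigenvalues: "finite (eigenvalues (M :: complex^'n^'n))"
proof -
  obtain p where p: "p \<noteq> 0" "peval M p = 0"
    by (rule annihilating_poly)
  have "eigenvalues M \<subseteq> {z. poly p z = 0}"
    using peval_eigenvector[of M _ _ p] by (fastforce simp: eigenvalues_def p)
  then show ?thesis
    using poly_roots_finite[OF p(1)] by (rule finite_subset)
qed

text \<open>Over the complex numbers an annihilating polynomial splits into linear factors; its
  nonzero leading coefficient can be cancelled.\<close>

lemma annihilating_roots:
  fixes M :: "complex^'n^'n"
  obtains Z where "peval M (\<Prod>z\<in>#Z. [:-z, 1:]) = 0"
proof -
  obtain p where p: "p \<noteq> 0" "peval M p = 0"
    by (rule annihilating_poly)
  obtain Z where Z: "p = smult (lead_coeff p) (\<Prod>z\<in>#Z. [:-z, 1:])"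
    using alg_closed_imp_factorization[OF p(1)] by blast
  have "mat (lead_coeff p) ** peval M (\<Prod>z\<in>#Z. [:-z, 1:]) = 0"
    unfolding peval_smult[symmetric] Z[symmetric] by (rule p)
  moreover have "lead_coeff p \<noteq> 0"
    using p(1) by simp
  ultimately have "peval M (\<Prod>z\<in>#Z. [:-z, 1:]) = 0"
    unfolding vec_eq_iff mat_mult_nth by simp
  then show ?thesis
    by (rule that)
qed

text \<open>Apply the linear factors of an annihilating polynomial one after another to a nonzero
  vector. The result is finally 0, and the last nonzero vector before that is an
  eigenvector.\<close>

lemma eigenvalues_nonempty: "eigenvalues (M :: complex^'n^'n) \<noteq> {}"
proof -
  obtain Z where Z: "peval M (\<Prod>z\<in>#Z. [:-z, 1:]) = 0"
    by (rule annihilating_roots)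
  have *: "v = 0 \<or> eigenvalues M \<noteq> {}" if "peval M (\<Prod>z\<in>#Z. [:-z, 1:]) *v v = 0" for v
    using that
  proof (induction Z)
    case (add z Z)
    \<comment> \<open>Either \<open>w\<close> is an eigenvector for \<open>z\<close>, or
      \<open>w = 0\<close> and the induction hypothesis applies with one factor fewer.\<close>
    define w where "w = peval M (\<Prod>z\<in>#Z. [:-z, 1:]) *v v"
    have "(M - mat z) *v w = 0"
      using add.prems unfolding w_def
      by (simp only: image_mset_add_mset prod_mset.add_mset peval_mult peval_linear_factor
          matrix_vector_mul_assoc)
    then have "M *v w = z *s w"
      by (simp add: matrix_vector_mult_diff_rdistrib mat_mult_vec)
    then have "w = 0 \<or> z \<in> eigenvalues M"
      unfolding eigenvalues_def by blast
    then have "w = 0 \<or> eigenvalues M \<noteq> {}"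
      by blast
    then show ?case
      using add.IH unfolding w_def by argo
  qed simp
  have "axis undefined 1 = (0 :: complex^'n) \<or> eigenvalues M \<noteq> {}"
    by (rule *) (simp only: Z matrix_vector_mult_0)
  then show ?thesis
    by (simp only: axis_eq_0_iff) simp
qed

section \<open>Summability of matrix powers\<close>

text \<open>Summing the recursion bounds each partial sum \<open>s\<close> of \<open>a\<close> by
  \<open>a 0 + r * s + suminf b\<close>; as \<open>r < 1\<close>, this can be solved for
  \<open>s\<close>, uniformly in the number of terms.\<close>

lemma summable_linear_recursion:
  fixes a b :: "nat \<Rightarrow> real"
  assumes a: "\<And>k. 0 \<le> a k" and b: "summable b" "\<And>k. 0 \<le> b k"
    and r: "r < 1" "0 \<le> r" and rec: "\<And>k. a (Suc k) \<le> r * a k + b k"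
  shows "summable a"
proof (rule bounded_imp_summable[OF a])
  fix n
  have "(\<Sum>k\<le>n. a k) \<le> (\<Sum>k\<le>Suc n. a k)"
    using a by simp
  also have "\<dots> = a 0 + (\<Sum>k\<le>n. a (Suc k))"
    by (rule sum.atMost_Suc_shift)
  also have "\<dots> \<le> a 0 + (\<Sum>k\<le>n. r * a k + b k)"
    by (intro add_left_mono sum_mono rec)
  also have "\<dots> = a 0 + r * (\<Sum>k\<le>n. a k) + (\<Sum>k\<le>n. b k)"
    by (simp add: sum.distrib sum_distrib_left)
  also have "(\<Sum>k\<le>n. b k) \<le> suminf b"
    using b by (intro sum_le_suminf) auto
  finally have "(1 - r) * (\<Sum>k\<le>n. a k) \<le> a 0 + suminf b"
    by (simp add: algebra_simps)
  then show "(\<Sum>k\<le>n. a k) \<le> (a 0 + suminf b) / (1 - r)"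
    using r by (simp add: pos_le_divide_eq mult.commute)
qed

text \<open>Peels off one factor \<open>M - z\<close> at a time: if \<open>z\<close> is not an eigenvalue the factor is invertible,
  otherwise \<open>\<bar>z\<bar> < 1\<close> and the powers satisfy a contractive recursion with summable error.\<close>

lemma summable_mpow_of_annihilated:
  fixes M X :: "complex^'n^'n"
  assumes ev: "\<And>z. z \<in> eigenvalues M \<Longrightarrow> cmod z < 1"
    and "peval M (\<Prod>z\<in>#Z. [:-z, 1:]) ** X = 0"
  shows "summable (\<lambda>k. norm (mpow M k ** X))"
  using assms(2)
proof (induction Z arbitrary: X)
  case empty
  then show ?case by simp
next
  case (add z Z)
  interpret mm: bounded_bilinear "(**) :: complex^'n^'n \<Rightarrow> complex^'n^'n \<Rightarrow> complex^'n^'n"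
    by (rule bounded_bilinear_matrix_matrix_mult)
  \<comment> \<open>\<open>Y\<close> absorbs the factor \<open>M - mat z\<close>, so the remaining
    factors annihilate it. This is why the induction is over arbitrary \<open>X\<close>.\<close>
  define Y where "Y = (M - mat z) ** X"
  have "peval M (\<Prod>z\<in>#Z. [:-z, 1:]) ** Y = 0"
    using add.prems unfolding Y_def image_mset_add_mset prod_mset.add_mset
    by (simp only: mult.commute[of "[:-z, 1:]"] peval_mult peval_linear_factor matrix_mul_assoc)
  then have sY: "summable (\<lambda>k. norm (mpow M k ** Y))"
    by (rule add.IH)
  have Yk: "mpow M k ** Y = (M - mat z) ** (mpow M k ** X)" for k
    unfolding Y_def matrix_mul_assoc
    by (simp add: matrix_diff_rdistrib matrix_diff_ldistrib mpow_commute mat_mult_commute)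
  show ?case
  proof (cases "z \<in> eigenvalues M")
    case True
    have "mpow M (Suc k) ** X = mat z ** (mpow M k ** X) + mpow M k ** Y" for k
      by (simp add: Yk matrix_diff_rdistrib matrix_mul_assoc)
    then have "norm (mpow M (Suc k) ** X) \<le> cmod z * norm (mpow M k ** X) + norm (mpow M k ** Y)" for k
      using norm_triangle_ineq[of "mat z ** (mpow M k ** X)" "mpow M k ** Y"]
      by (simp only: norm_mat_mult)
    then show ?thesis
      by (intro summable_linear_recursion[OF _ sY _ ev[OF True]]) auto
  next
    case False
    then have "\<forall>v. (M - mat z) *v v = 0 \<longrightarrow> v = 0"
      by (auto simp: eigenvalues_def matrix_vector_mult_diff_rdistrib mat_mult_vec)
    then obtain L where L: "L ** (M - mat z) = mat 1"
      unfolding matrix_left_invertible_ker[symmetric] by blast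
    obtain c where c: "\<And>(P :: complex^'n^'n) (Q :: complex^'n^'n). norm (P ** Q) \<le> norm P * norm Q * c"
      using mm.bounded by blast
    \<comment> \<open>The left inverse recovers the powers on \<open>X\<close> from those on
      \<open>Y\<close>, at the cost of a factor independent of \<open>k\<close>.\<close>
    have "mpow M k ** X = L ** (mpow M k ** Y)" for k
      by (simp add: Yk matrix_mul_assoc L)
    then have "norm (mpow M k ** X) \<le> norm L * c * norm (mpow M k ** Y)" for k
      using c[of L "mpow M k ** Y"] by (simp add: mult_ac)
    then show ?thesis
      by (intro summable_comparison_test'[OF summable_mult[OF sY], where N = 0]) simp
  qed
qed

lemma summable_norm_mpow_complex:
  fixes M :: "complex^'n^'n"
  assumes "\<And>z. z \<in> eigenvalues M \<Longrightarrow> cmod z < 1"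
  shows "summable (\<lambda>k. norm (mpow M k))"
proof -
  obtain Z where "peval M (\<Prod>z\<in>#Z. [:-z, 1:]) = 0"
    by (rule annihilating_roots)
  then have "peval M (\<Prod>z\<in>#Z. [:-z, 1:]) ** mat 1 = 0"
    unfolding matrix_mul_rid .
  then have "summable (\<lambda>k. norm (mpow M k ** mat 1))"
    by (rule summable_mpow_of_annihilated[rotated]) (rule assms)
  then show ?thesis
    unfolding matrix_mul_rid .
qed

section \<open>Transfer to real matrices and their spectral radius\<close>

definition complex_matrix :: "real^'n^'m \<Rightarrow> complex^'n^'m" where
  "complex_matrix M = (\<chi> i j. complex_of_real (M $ i $ j))"

lemma norm_complex_matrix [simp]: "norm (complex_matrix M) = norm M"
  by (simp add: complex_matrix_def norm_vec_def)

lemma mpow_complex_matrix: "mpow (complex_matrix M) k = complex_matrix (mpow M k)"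
  by (induction k) (simp_all add: complex_matrix_def vec_eq_iff mat_def matrix_matrix_mult_def)

lemma complex_eigenvalues_eq: "complex_eigenvalues M = eigenvalues (complex_matrix M)"
  by (simp add: complex_eigenvalues_def eigenvalues_def complex_matrix_def)

text \<open>Finiteness and nonemptiness of the spectrum are what give \<open>Max\<close> its
  intended meaning.\<close>

lemma spec_rad_less_iff: "spec_rad M < r \<longleftrightarrow> (\<forall>z\<in>complex_eigenvalues M. cmod z < r)"
  by (simp add: spec_rad_def complex_eigenvalues_eq finite_eigenvalues eigenvalues_nonempty)

lemma summable_norm_mpow:
  assumes "spec_rad M < 1"
  shows "summable (\<lambda>k. norm (mpow M k))"
  using summable_norm_mpow_complex[of "complex_matrix M"] assms
  by (simp add: spec_rad_less_iff complex_eigenvalues_eq mpow_complex_matrix)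

lemma mpow_eigenvector:
  assumes "M *v v = z *s (v :: 'a::field^'n)"
  shows "mpow M k *v v = z ^ k *s v"
  using peval_eigenvector[OF assms, of "monom 1 k"] by (simp add: peval_monom poly_monom)

text \<open>An eigenvector for \<open>z\<close> is scaled by \<open>z ^ k\<close> under
  \<open>mpow M k\<close>, so a small norm of this power forces \<open>cmod z ^ k < 1\<close>. The
  threshold \<open>e\<close> depends neither on \<open>M\<close> nor on \<open>k\<close>, which
  later turns stability into an open condition.\<close>

lemma spec_rad_less_1:
  obtains e where "e > 0" "\<And>(M :: real^'n^'n) k. norm (mpow M k) < e \<Longrightarrow> spec_rad M < 1"
proof -
  obtain c where c: "c > 0" "\<And>(P :: complex^'n^'n) x. norm (P *v x) \<le> norm P * norm x * c"
    using bounded_bilinear.pos_bounded[OF bounded_bilinear_matrix_vector_mult] by blast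
  show ?thesis
  proof (rule that)
    show "1 / c > 0"
      using c by simp
    fix M :: "real^'n^'n" and k
    assume k: "norm (mpow M k) < 1 / c"
    have "cmod z < 1" if "v \<noteq> 0" "complex_matrix M *v v = z *s v" for z v
    proof -
      have "cmod z ^ k * norm v = norm (complex_matrix (mpow M k) *v v)"
        unfolding mpow_complex_matrix[symmetric] mpow_eigenvector[OF that(2)]
        by (simp add: norm_vec_def norm_mult norm_power L2_set_right_distrib)
      also have "\<dots> \<le> (norm (mpow M k) * c) * norm v"
        using c(2)[of "complex_matrix (mpow M k)" v] by (simp add: mult_ac)
      also have "\<dots> < 1 * norm v"
        using k c(1) that(1) by (intro mult_strict_right_mono) (auto simp: field_simps)
      finally have "cmod z ^ k < 1"
        using that(1) by (simp del: norm_power)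
      then show ?thesis
        by (meson not_less one_le_power)
    qed
    then show "spec_rad M < 1"
      by (auto simp: spec_rad_less_iff complex_eigenvalues_eq eigenvalues_def)
  qed
qed


section \<open>Quadratic forms and second moments\<close>

text \<open>The inner product of matrices is the trace form, so a quadratic form in \<open>x\<close>
  is linear in \<open>outer_square x\<close>. Expectations of quadratic forms thus depend on the
  second moment matrix only.\<close>

lemma inner_outer_square: "W \<bullet> outer_square x = x \<bullet> (W *v x)"
  by (simp add: inner_vec_def outer_square_def matrix_vector_mult_def sum_distrib_left mult_ac)

lemma norm_transpose [simp]: "norm (transpose M) = norm (M :: real^'n^'m)"
proof -
  have "transpose M \<bullet> transpose M = M \<bullet> M"
    unfolding inner_vec_def transpose_def by (simp, subst sum.swap) simp
  then show ?thesis
    by (simp add: norm_eq_sqrt_inner)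
qed

lemma inner_mult_matrix_mult:
  fixes M :: "real^'n^'m"
  shows "(M *v x) \<bullet> (S *v (M *v x)) = x \<bullet> ((transpose M ** S ** M) *v x)"
  by (metis dot_lmul_matrix matrix_vector_mul_assoc vector_transpose_matrix inner_commute)

text \<open>The constant is the minimum of the form on the compact unit sphere; homogeneity of
  degree two extends the bound to all vectors.\<close>

lemma sym_pos_def_bounded_below:
  assumes "sym_pos_def S"
  obtains c where "c > 0" "\<And>x. c * (norm x)\<^sup>2 \<le> x \<bullet> (S *v x)"
proof -
  have "continuous_on (sphere 0 1) (\<lambda>x. x \<bullet> (S *v x))"
    by (intro continuous_intros linear_continuous_on) simp
  moreover have "axis undefined 1 \<in> sphere (0 :: real^'a) 1"
    by simp
  ultimately obtain u where u: "u \<in> sphere 0 1" "\<And>x. x \<in> sphere 0 1 \<Longrightarrow> u \<bullet> (S *v u) \<le> x \<bullet> (S *v x)"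
    using continuous_attains_inf[OF compact_sphere] by blast
  show ?thesis
  proof (rule that)
    show "u \<bullet> (S *v u) > 0"
      using assms u(1) unfolding sym_pos_def_def by (metis mem_sphere_0 norm_zero zero_neq_one)
    show "(u \<bullet> (S *v u)) * (norm x)\<^sup>2 \<le> x \<bullet> (S *v x)" for x
    proof (cases "x = 0")
      case False
      define y where "y = x /\<^sub>R norm x"
      have "u \<bullet> (S *v u) \<le> y \<bullet> (S *v y)"
        using False by (intro u(2)) (simp add: y_def)
      moreover have "x = norm x *\<^sub>R y"
        using False by (simp add: y_def)
      then have "x \<bullet> (S *v x) = (norm x)\<^sup>2 * (y \<bullet> (S *v y))"
        by (metis inner_scaleR_left inner_scaleR_right matrix_vector_mult_scaleR mult.assoc power2_eq_square)
      ultimately show ?thesis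
        by (simp add: mult.commute[of _ "_ \<bullet> _"] mult_right_mono)
    qed simp
  qed
qed

lemma integrable_quadratic_form:
  assumes "integrable D outer_square"
  shows "integrable D (\<lambda>x. x \<bullet> (W *v x))"
  using integrable_inner_right[of W D outer_square] assms by (simp add: inner_outer_square)

lemma integral_quadratic_form:
  assumes "integrable D outer_square"
  shows "(\<integral>x. x \<bullet> (W *v x) \<partial>D) = W \<bullet> (\<integral>x. outer_square x \<partial>D)"
  using integral_inner_right[of W D outer_square] assms by (simp add: inner_outer_square)

lemma norm_matrix_vector_mult_sq: "(norm (L *v x))\<^sup>2 = x \<bullet> ((transpose L ** L) *v (x :: real^'n))"
  using inner_mult_matrix_mult[of L x "mat 1"] by (simp add: power2_norm_eq_inner)

lemma integrable_norm_matrix_vector_mult_sq: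
  assumes "integrable D outer_square"
  shows "integrable D (\<lambda>x. (norm (L *v x))\<^sup>2)"
  unfolding norm_matrix_vector_mult_sq by (rule integrable_quadratic_form[OF assms])

text \<open>The integral is \<open>Tr (L X0 L\<^sup>T)\<close>, the sum over the rows \<open>l\<close> of \<open>L\<close> of \<open>l \<bullet> X0 l\<close>.\<close>

lemma integral_norm_matrix_vector_mult_sq_ge:
  fixes D :: "(real^'n) measure" and L :: "real^'n^'m"
  assumes D: "integrable D outer_square"
    and c: "\<And>x. c * (norm x)\<^sup>2 \<le> x \<bullet> ((\<integral>x. outer_square x \<partial>D) *v x)"
  shows "c * (norm L)\<^sup>2 \<le> (\<integral>x. (norm (L *v x))\<^sup>2 \<partial>D)"
proof -
  have sq: "(L $ i \<bullet> x)\<^sup>2 = x \<bullet> (outer_square (L $ i) *v x)" for i x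
    by (subst inner_outer_square[symmetric])
       (simp add: inner_vec_def[where 'b = 'n] outer_square_def power2_eq_square sum_product mult_ac)
  have "c * (norm L)\<^sup>2 = (\<Sum>i\<in>UNIV. c * (norm (L $ i))\<^sup>2)"
    by (simp add: power2_norm_eq_inner inner_vec_def[of L] sum_distrib_left)
  \<comment> \<open>The inner product of the outer square of a row \<open>l\<close> with the second
    moment matrix is also the quadratic form of that matrix at \<open>l\<close>, to which
    \<open>c\<close> applies.\<close>
  also have "\<dots> \<le> (\<Sum>i\<in>UNIV. \<integral>x. (L $ i \<bullet> x)\<^sup>2 \<partial>D)"
    unfolding sq integral_quadratic_form[OF D]
    by (intro sum_mono) (metis c inner_commute inner_outer_square)
  also have "\<dots> = (\<integral>x. (\<Sum>i\<in>UNIV. (L $ i \<bullet> x)\<^sup>2) \<partial>D)"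
    unfolding sq by (intro Bochner_Integration.integral_sum[symmetric] integrable_quadratic_form D)
  also have "(\<lambda>x. \<Sum>i\<in>UNIV. (L $ i \<bullet> x)\<^sup>2) = (\<lambda>x. (norm (L *v x))\<^sup>2)"
    unfolding power2_norm_eq_inner inner_vec_def[of "L *v _"]
    by (simp add: matrix_vector_mul_component power2_eq_square)
  finally show ?thesis .
qed

section \<open>Bounds on the cost\<close>

lemma trajectory_eq: "trajectory M x t = mpow M t *v x"
  by (induction t) (simp_all add: matrix_vector_mul_assoc)

text \<open>A summable sequence is bounded, say by \<open>b\<close>, so its squares are dominated by
  \<open>b\<close> times the sequence.\<close>

lemma summable_norm_mpow_sq:
  assumes "spec_rad M < 1"
  shows "summable (\<lambda>t. (norm (mpow M t))\<^sup>2)"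
proof -
  have s: "summable (\<lambda>t. norm (mpow M t))"
    by (rule summable_norm_mpow[OF assms])
  obtain b where b: "\<And>t. norm (norm (mpow M t)) \<le> b"
    using summable_LIMSEQ_zero[OF s] by (metis convergentI convergent_imp_Bseq BseqE)
  have "norm ((norm (mpow M t))\<^sup>2) \<le> b * norm (mpow M t)" for t
    using b[of t] by (simp add: power2_eq_square mult_right_mono)
  then show ?thesis
    by (intro summable_comparison_test'[OF summable_mult[OF s], where N = 0]) simp
qed

text \<open>The stage cost at time \<open>t\<close> is the fixed linear functional
  \<open>W t\<close> of \<open>outer_square x\<close>. Since the matrices \<open>W t\<close> are
  summable, the series is summed before integrating, and exchanging sum and expectation reduces to
  linearity.\<close>

lemma sof_cost_sums:
  fixes A :: "real^'n^'n" and B :: "real^'m^'n" and C :: "real^'n^'d" and K :: "real^'d^'m"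
  defines "M \<equiv> closed_loop A B C K"
    and "S \<equiv> \<lambda>Q R. Q + transpose C ** transpose K ** R ** K ** C"
  assumes K: "spec_rad M < 1" and D: "integrable D outer_square"
  shows "(\<lambda>t. \<integral>x. (mpow M t *v x) \<bullet> (S Q R *v (mpow M t *v x)) \<partial>D) sums sof_cost A B C Q R D K"
proof -
  define W where "W t = transpose (mpow M t) ** S Q R ** mpow M t" for t
  obtain c where c: "c > 0" "\<And>(X :: real^'n^'n) (Y :: real^'n^'n). norm (X ** Y) \<le> norm X * norm Y * c"
    using bounded_bilinear.pos_bounded[OF bounded_bilinear_matrix_matrix_mult] by blast
  have "norm (W t) \<le> (c * c * norm (S Q R)) * (norm (mpow M t))\<^sup>2" for t
  proof -
    have "norm (W t) \<le> norm (transpose (mpow M t) ** S Q R) * norm (mpow M t) * c"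
      unfolding W_def by (rule c)
    also have "\<dots> \<le> (norm (transpose (mpow M t)) * norm (S Q R) * c) * norm (mpow M t) * c"
      using c by (intro mult_right_mono c) auto
    finally show ?thesis
      by (simp add: power2_eq_square mult_ac)
  qed
  then have "summable (\<lambda>t. norm (W t))"
    by (intro summable_comparison_test'[OF summable_mult[OF summable_norm_mpow_sq[OF K]], where N = 0])
       simp
  then have W: "summable W"
    by (rule summable_norm_cancel)
  have q: "(mpow M t *v x) \<bullet> (S Q R *v (mpow M t *v x)) = W t \<bullet> outer_square x" for t x
    by (simp add: inner_outer_square W_def inner_mult_matrix_mult)
  have "sof_cost A B C Q R D K = (\<integral>x. (\<Sum>t. W t \<bullet> outer_square x) \<partial>D)"
    unfolding sof_cost_def M_def[symmetric] trajectory_eq q[symmetric] S_def ..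
  also have "\<dots> = (\<integral>x. suminf W \<bullet> outer_square x \<partial>D)"
    by (simp add: bounded_linear.suminf[OF bounded_linear_inner_left W])
  also have "\<dots> = suminf W \<bullet> (\<integral>x. outer_square x \<partial>D)"
    using D by (intro integral_inner_right) simp
  finally have "sof_cost A B C Q R D K = suminf W \<bullet> (\<integral>x. outer_square x \<partial>D)" .
  moreover have "(\<integral>x. W t \<bullet> outer_square x \<partial>D) = W t \<bullet> (\<integral>x. outer_square x \<partial>D)" for t
    using D by (intro integral_inner_right) simp
  ultimately show ?thesis
    unfolding q using bounded_linear.sums[OF bounded_linear_inner_left summable_sums[OF W]] by simp
qed

text \<open>The part of the stage cost from \<open>Q\<close> controls the powers of the closed loop
  at every time; the part from \<open>R\<close> at time 0, where the state is still
  \<open>x0\<close>, controls \<open>K ** C\<close>. The second moment matrix converts both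
  expectations into matrix norms.\<close>

lemma sof_cost_lower_bounds:
  fixes A :: "real^'n^'n" and B :: "real^'m^'n" and C :: "real^'n^'d"
  assumes Q: "sym_pos_def Q" and R: "sym_pos_def R"
    and D: "integrable D outer_square" and X: "sym_pos_def (\<integral>x. outer_square x \<partial>D)"
  obtains a where "a > 0"
    "\<And>K N. K \<in> stabilizing_gains A B C \<Longrightarrow>
       a * (\<Sum>t<N. (norm (mpow (closed_loop A B C K) t))\<^sup>2) \<le> sof_cost A B C Q R D K"
    "\<And>K. K \<in> stabilizing_gains A B C \<Longrightarrow> a * (norm (K ** C))\<^sup>2 \<le> sof_cost A B C Q R D K"
proof -
  obtain p where p: "p > 0" "\<And>x. p * (norm x)\<^sup>2 \<le> x \<bullet> (Q *v x)"
    using sym_pos_def_bounded_below[OF Q] by blast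
  obtain r where r: "r > 0" "\<And>x. r * (norm x)\<^sup>2 \<le> x \<bullet> (R *v x)"
    using sym_pos_def_bounded_below[OF R] by blast
  obtain c where c: "c > 0" "\<And>x. c * (norm x)\<^sup>2 \<le> x \<bullet> ((\<integral>x. outer_square x \<partial>D) *v x)"
    using sym_pos_def_bounded_below[OF X] by blast
  have *: "c * p * (\<Sum>t<N. (norm (mpow (closed_loop A B C K) t))\<^sup>2) \<le> sof_cost A B C Q R D K"
      "c * r * (norm (K ** C))\<^sup>2 \<le> sof_cost A B C Q R D K"
    if K: "K \<in> stabilizing_gains A B C" for K N
  proof -
    define M where "M = closed_loop A B C K"
    define S where "S = Q + transpose C ** transpose K ** R ** K ** C"
    define J where "J t = (\<integral>x. (mpow M t *v x) \<bullet> (S *v (mpow M t *v x)) \<partial>D)" for t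
    have "spec_rad M < 1"
      using K by (simp add: stabilizing_gains_def M_def)
    then have J: "J sums sof_cost A B C Q R D K"
      unfolding J_def M_def S_def by (rule sof_cost_sums[OF _ D])
    have S: "y \<bullet> (S *v y) = y \<bullet> (Q *v y) + (K ** C *v y) \<bullet> (R *v (K ** C *v y))" for y
      unfolding S_def inner_mult_matrix_mult
      by (simp add: matrix_vector_mult_add_rdistrib inner_add_right matrix_transpose_mul matrix_mul_assoc)
    have Sp: "p * (norm y)\<^sup>2 \<le> y \<bullet> (S *v y)" for y
      using p(2)[of y] order_trans[OF _ r(2)[of "K ** C *v y"]] r(1) by (simp add: S add_increasing2)
    have Sr: "r * (norm (K ** C *v y))\<^sup>2 \<le> y \<bullet> (S *v y)" for y
      using r(2)[of "K ** C *v y"] order_trans[OF _ p(2)[of y]] p(1) by (simp add: S add_increasing)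
    have int: "integrable D (\<lambda>x. (mpow M t *v x) \<bullet> (S *v (mpow M t *v x)))" for t
      unfolding inner_mult_matrix_mult by (rule integrable_quadratic_form[OF D])
    have Jp: "c * p * (norm (mpow M t))\<^sup>2 \<le> J t" for t
    proof -
      have "c * p * (norm (mpow M t))\<^sup>2 \<le> p * (\<integral>x. (norm (mpow M t *v x))\<^sup>2 \<partial>D)"
        using integral_norm_matrix_vector_mult_sq_ge[OF D c(2), of "mpow M t"] p(1)
        by (simp add: mult.left_commute mult.commute mult.assoc mult_left_mono)
      also have "\<dots> = (\<integral>x. p * (norm (mpow M t *v x))\<^sup>2 \<partial>D)"
        by simp
      also have "\<dots> \<le> J t"
        unfolding J_def
        by (intro integral_mono int Sp integrable_mult_right integrable_norm_matrix_vector_mult_sq D)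
      finally show ?thesis .
    qed
    \<comment> \<open>Nonnegative terms let every partial sum bound the cost from below.\<close>
    have J_nonneg: "0 \<le> J t" for t
      using p(1) c(1) by (intro order_trans[OF _ Jp]) simp
    have sum: "sum J {..<N} \<le> sof_cost A B C Q R D K" for N
      using sum_le_suminf[OF sums_summable[OF J], of "{..<N}"] J_nonneg sums_unique[OF J] by simp
    have "c * p * (\<Sum>t<N. (norm (mpow M t))\<^sup>2) \<le> sum J {..<N}"
      unfolding sum_distrib_left by (intro sum_mono Jp)
    with sum show "c * p * (\<Sum>t<N. (norm (mpow (closed_loop A B C K) t))\<^sup>2) \<le> sof_cost A B C Q R D K"
      unfolding M_def by (meson order_trans)
    have "c * r * (norm (K ** C))\<^sup>2 \<le> r * (\<integral>x. (norm (K ** C *v x))\<^sup>2 \<partial>D)"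
      using integral_norm_matrix_vector_mult_sq_ge[OF D c(2), of "K ** C"] r(1)
      by (simp add: mult.left_commute mult.commute mult.assoc mult_left_mono)
    also have "\<dots> = (\<integral>x. r * (norm (K ** C *v x))\<^sup>2 \<partial>D)"
      by simp
    also have "\<dots> \<le> (\<integral>x. x \<bullet> (S *v x) \<partial>D)"
      by (intro integral_mono Sr integrable_mult_right integrable_norm_matrix_vector_mult_sq
          integrable_quadratic_form D)
    also have "\<dots> = J 0"
      by (simp add: J_def)
    \<comment> \<open>The partial sum over \<open>t < 1\<close> consists of \<open>J 0\<close>
      alone.\<close>
    also have "\<dots> \<le> sof_cost A B C Q R D K"
      using sum[of 1] by simp
    finally show "c * r * (norm (K ** C))\<^sup>2 \<le> sof_cost A B C Q R D K" .
  qed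
  show ?thesis
  proof (rule that)
    show "min (c * p) (c * r) > 0"
      using p(1) r(1) c(1) by simp
    fix K assume K: "K \<in> stabilizing_gains A B C"
    show "min (c * p) (c * r) * (\<Sum>t<N. (norm (mpow (closed_loop A B C K) t))\<^sup>2) \<le> sof_cost A B C Q R D K" for N
      by (rule order_trans[OF mult_right_mono *(1)[OF K]]) (auto intro: sum_nonneg)
    show "min (c * p) (c * r) * (norm (K ** C))\<^sup>2 \<le> sof_cost A B C Q R D K"
      by (rule order_trans[OF mult_right_mono *(2)[OF K]]) auto
  qed
qed

section \<open>Growth of the gain and interior stabilizing gains\<close>

text \<open>Independent rows give \<open>C\<close> a right inverse \<open>E\<close>, and then
  \<open>K = (K ** C) ** E\<close>.\<close>

lemma onorm_le_norm_mult:
  fixes C :: "real^'n^'d"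
  assumes "independent_rows C"
  obtains b where "b > 0" "\<And>K :: real^'d^'m. onorm ((*v) K) \<le> b * norm (K ** C)"
proof -
  have "\<forall>i. f i = 0" if "(\<Sum>i\<in>UNIV. f i *s row i C) = 0" for f
  proof -
    have inj: "inj (\<lambda>i. row i C)" and ind: "independent (rows C)"
      using assms by (auto simp: independent_rows_def)
    have rows: "rows C = range (\<lambda>i. row i C)"
      by (auto simp: rows_def)
    \<comment> \<open>\<open>independent\<close> concerns the set of rows, so the coefficients are
      moved from indices to rows along the injection.\<close>
    have "(\<Sum>v\<in>rows C. f (the_inv (\<lambda>i. row i C) v) *\<^sub>R v) = 0"
      unfolding rows sum.reindex[OF inj] using that
      by (simp add: the_inv_f_f[OF inj] scalar_mult_eq_scaleR)
    then have "f (the_inv (\<lambda>i. row i C) (row i C)) = 0" for i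
      using ind unfolding independent_explicit by (auto simp: rows)
    then show ?thesis
      by (simp add: the_inv_f_f[OF inj])
  qed
  then have "\<exists>E :: real^'d^'n. C ** E = mat 1"
    unfolding matrix_right_invertible_independent_rows by blast
  then obtain E :: "real^'d^'n" where E: "C ** E = mat 1" ..
  obtain c where c: "c > 0" "\<And>(X :: real^'n^'m) (Y :: real^'d^'n). norm (X ** Y) \<le> norm X * norm Y * c"
    using bounded_bilinear.pos_bounded[OF bounded_bilinear_matrix_matrix_mult] by blast
  obtain d where d: "d > 0" "\<And>(X :: real^'d^'m) y. norm (X *v y) \<le> norm X * norm y * d"
    using bounded_bilinear.pos_bounded[OF bounded_bilinear_matrix_vector_mult] by blast
  show ?thesis
  proof (rule that)
    \<comment> \<open>The added 1 makes the constant positive without a separate proof that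
      \<open>E\<close> is nonzero.\<close>
    show "0 < c * d * (norm E + 1)"
      using c(1) d(1) by (simp add: add_nonneg_pos)
    fix K :: "real^'d^'m"
    have "onorm ((*v) K) \<le> d * norm K"
      using d(2)[of K] by (intro onorm_le) (simp add: mult_ac)
    also have "norm K \<le> norm (K ** C) * norm E * c"
      using c(2)[of "K ** C" E] by (simp add: matrix_mul_assoc[symmetric] E)
    also have "\<dots> \<le> norm (K ** C) * (norm E + 1) * c"
      using c(1) by (intro mult_mono) auto
    finally show "onorm ((*v) K) \<le> c * d * (norm E + 1) * norm (K ** C)"
      using d(1) by (simp add: mult_ac)
  qed
qed

lemma continuous_mpow_closed_loop:
  "continuous_on UNIV (\<lambda>K. mpow (closed_loop A B C K) t)"
proof -
  have "continuous_on UNIV (\<lambda>K. closed_loop A B C K)"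
    unfolding closed_loop_def
    by (intro continuous_intros bounded_bilinear.continuous_on[OF bounded_bilinear_matrix_matrix_mult])
  then show ?thesis
    by (induction t)
       (auto intro!: bounded_bilinear.continuous_on[OF bounded_bilinear_matrix_matrix_mult])
qed

text \<open>Bounded sums of squares make some power smaller than the uniform threshold
  \<open>e\<close>. With this exponent fixed, the inequality is an open condition on the gain and
  implies stability.\<close>

lemma interior_stabilizing_gains:
  fixes A :: "real^'n^'n"
  assumes b: "\<And>N. (\<Sum>t<N. (norm (mpow (closed_loop A B C K) t))\<^sup>2) \<le> b"
  shows "K \<in> interior (stabilizing_gains A B C)"
proof -
  obtain e where e: "e > 0" "\<And>(M :: real^'n^'n) k. norm (mpow M k) < e \<Longrightarrow> spec_rad M < 1"
    using spec_rad_less_1 by blast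
  have "summable (\<lambda>t. (norm (mpow (closed_loop A B C K) t))\<^sup>2)"
    using b by (intro summableI_nonneg_bounded) auto
  then have "(\<lambda>t. (norm (mpow (closed_loop A B C K) t))\<^sup>2) \<longlonglongrightarrow> 0"
    by (rule summable_LIMSEQ_zero)
  then have "\<forall>\<^sub>F t in sequentially. (norm (mpow (closed_loop A B C K) t))\<^sup>2 < e\<^sup>2"
    by (rule order_tendstoD(2)) (use e(1) in simp)
  then obtain t where "(norm (mpow (closed_loop A B C K) t))\<^sup>2 < e\<^sup>2"
    by (meson eventually_happens' sequentially_bot)
  then have t: "norm (mpow (closed_loop A B C K) t) < e"
    by (rule power2_less_imp_less) (use e(1) in simp)
  have "open {K. norm (mpow (closed_loop A B C K) t) < e}"
    by (intro open_Collect_less continuous_intros continuous_mpow_closed_loop)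
  moreover have "K \<in> {K. norm (mpow (closed_loop A B C K) t) < e}"
    using t by simp
  moreover have "{K. norm (mpow (closed_loop A B C K) t) < e} \<subseteq> stabilizing_gains A B C"
    unfolding stabilizing_gains_def using e(2) by blast
  ultimately show ?thesis
    by (rule interiorI)
qed

section \<open>Coercivity at the boundary and at infinity\<close>

theorem lemma3:
  fixes A :: "real^'n^'n" and B :: "real^'m^'n" and C :: "real^'n^'d"
    and Q :: "real^'n^'n" and R :: "real^'m^'m"
    and D :: "(real^'n) measure"
    and Ks :: "nat \<Rightarrow> real^'d^'m"
  assumes "controllable A B"
    and "observable C A"
    and "independent_rows C"
    and "sym_pos_def Q"
    and "sym_pos_def R"
    and "prob_space D"
    and "sets D = sets borel"
    and "integrable D outer_square"
    and "sym_pos_def (\<integral>x0. outer_square x0 \<partial>D)"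
    and "stabilizing_gains A B C \<noteq> {}"
    and "\<And>i. Ks i \<in> stabilizing_gains A B C"
    and "(\<exists>K \<in> frontier (stabilizing_gains A B C). Ks \<longlonglongrightarrow> K) \<or>
         filterlim (\<lambda>i. onorm ((*v) (Ks i))) at_top sequentially"
  shows "filterlim (\<lambda>i. sof_cost A B C Q R D (Ks i)) at_top sequentially"
proof -
  obtain a where a: "a > 0"
    "\<And>K N. K \<in> stabilizing_gains A B C \<Longrightarrow>
       a * (\<Sum>t<N. (norm (mpow (closed_loop A B C K) t))\<^sup>2) \<le> sof_cost A B C Q R D K"
    "\<And>K. K \<in> stabilizing_gains A B C \<Longrightarrow> a * (norm (K ** C))\<^sup>2 \<le> sof_cost A B C Q R D K"
    using sof_cost_lower_bounds[OF assms(4,5,8,9)] by metis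
  from assms(12) show ?thesis
  proof
    assume "\<exists>K \<in> frontier (stabilizing_gains A B C). Ks \<longlonglongrightarrow> K"
    then obtain K where K: "K \<notin> interior (stabilizing_gains A B C)" "Ks \<longlonglongrightarrow> K"
      by (auto simp: frontier_def)
    show ?thesis
      unfolding filterlim_at_top
    proof
      fix z
      \<comment> \<open>If all partial sums were at most \<open>z / a\<close>, then \<open>K\<close>
        would be an interior point.\<close>
      obtain N where N: "z / a < (\<Sum>t<N. (norm (mpow (closed_loop A B C K) t))\<^sup>2)"
        using interior_stabilizing_gains[of A B C K "z / a"] K(1) not_le by blast
      \<comment> \<open>With \<open>N\<close> fixed, the sum is a continuous function of the gain,
        so the strict inequality at \<open>K\<close> persists for late \<open>Ks i\<close>.\<close>
      have "(\<lambda>i. \<Sum>t<N. (norm (mpow (closed_loop A B C (Ks i)) t))\<^sup>2)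
          \<longlonglongrightarrow> (\<Sum>t<N. (norm (mpow (closed_loop A B C K) t))\<^sup>2)"
        by (intro tendsto_intros continuous_on_tendsto_compose[OF continuous_mpow_closed_loop K(2)]) auto
      then have "\<forall>\<^sub>F i in sequentially. z / a < (\<Sum>t<N. (norm (mpow (closed_loop A B C (Ks i)) t))\<^sup>2)"
        using N by (rule order_tendstoD(1))
      then show "\<forall>\<^sub>F i in sequentially. z \<le> sof_cost A B C Q R D (Ks i)"
      proof eventually_elim
        case (elim i)
        then have "z \<le> a * (\<Sum>t<N. (norm (mpow (closed_loop A B C (Ks i)) t))\<^sup>2)"
          using a(1) by (simp add: divide_less_eq mult.commute)
        then show ?case
          using a(2)[OF assms(11)] by (rule order_trans)
      qed
    qed
  next
    assume lim: "filterlim (\<lambda>i. onorm ((*v) (Ks i))) at_top sequentially"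
    obtain b where b: "b > 0" "\<And>K :: real^'d^'m. onorm ((*v) K) \<le> b * norm (K ** C)"
      using onorm_le_norm_mult[OF assms(3)] by blast
    have "filterlim (\<lambda>i. norm (Ks i ** C)) at_top sequentially"
    proof (rule filterlim_at_top_mono)
      show "filterlim (\<lambda>i. inverse b * onorm ((*v) (Ks i))) at_top sequentially"
        using b(1) by (intro filterlim_tendsto_pos_mult_at_top[OF tendsto_const _ lim]) simp
      show "\<forall>\<^sub>F i in sequentially. inverse b * onorm ((*v) (Ks i)) \<le> norm (Ks i ** C)"
        using b by (simp add: field_simps)
    qed
    then have "filterlim (\<lambda>i. a * (norm (Ks i ** C))\<^sup>2) at_top sequentially"
      using a(1) by (intro filterlim_tendsto_pos_mult_at_top[OF tendsto_const] filterlim_pow_at_top) auto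
    then show ?thesis
      by (rule filterlim_at_top_mono) (simp add: a(3) assms(11))
  qed
qed

end
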